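(* All binary self-dual $(4,2)$ convolutional codes can be constructed with the generalized Harada-Munemasa construction. That is, for every binary self-dual $(4,2)$ convolutional code $\mathcal{C}$ there exist a generator matrix $G(z)\in\mathbb{F}_2[z]^{1\times 2}$ of a binary self-dual $(2,1)$ convolutional code, a polynomial $a_1(z)\in\mathbb{F}_2[z]$ and a vector $f(z)\in\mathbb{F}_2[z]^4$ such that $$\begin{pmatrix} f(z)\\ a_1(z)\ \ a_1(z)\ \ G(z)\end{pmatrix}\in\mathbb{F}_2[z]^{2\times 4}$$ is a generator matrix of $\mathcal{C}$.
   Context: A binary $(n,k)$ convolutional code is an $\mathbb{F}_2[z]$-submodule $\mathcal{C}\subset\mathbb{F}_2[z]^n$ of rank $k$. A generator matrix of $\mathcal{C}$ is a matrix in $\mathbb{F}_2[z]^{k\times n}$ whose rows form a basis of $\mathcal{C}$. The dual is $\mathcal{C}^\perp=\{f(z)\in\mathbb{F}_2[z]^n : f(z)c(z)^\top=0\ \forall c(z)\in\mathcal{C}\}$, and $\mathcal{C}$ is self-dual if $\mathcal{C}=\mathcal{C}^\perp$. Generalized Harada-Munemasa construction: given a generator matrix $G(z)$ (rows $g_1(z),\dots,g_k(z)$) of a binary self-dual $(2k,k)$ convolutional code and $a_1(z),\dots,a_k(z)\in\mathbb{F}_2[z]$, form the $k\times(2k+2)$ matrix with rows $(a_i(z),a_i(z),g_i(z))$ and add on top a row $f(z)\in\mathbb{F}_2[z]^{2k+2}$ such that the resulting $(k+1)\times(2k+2)$ matrix generates a self-dual convolutional code. *)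

theory Defs
  imports
    "HOL-Library.Z2"
    "HOL-Computational_Algebra.Polynomial"
    "Jordan_Normal_Form.Matrix"
    "Jordan_Normal_Form.VS_Connect"
begin

text \<open>\<^typ>\<open>bit\<close> is the field with two elements, so \<^typ>\<open>bit poly\<close> is its polynomial ring and
  \<^term>\<open>carrier_vec n :: bit poly vec set\<close> is the free module of row vectors of length \<^term>\<open>n\<close>.\<close>

abbreviation poly_module :: "nat \<Rightarrow> (bit poly, bit poly vec) module" where
  "poly_module n \<equiv> module_vec TYPE(bit poly) n"

definition is_basis :: "nat \<Rightarrow> bit poly vec set \<Rightarrow> bit poly vec set \<Rightarrow> bool" where
  "is_basis n B C \<longleftrightarrow>
     B \<subseteq> carrier_vec n \<and>
     \<not> LinearCombinations.module.lin_dep class_ring (poly_module n) B \<and>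
     LinearCombinations.module.span class_ring (poly_module n) B = C"

text \<open>Submodules of a free module of finite rank over a principal ideal domain are free; the rank is
  the cardinality of a basis.\<close>

definition conv_code :: "nat \<Rightarrow> nat \<Rightarrow> bit poly vec set \<Rightarrow> bool" where
  "conv_code n k C \<longleftrightarrow>
     submodule class_ring C (poly_module n) \<and>
     (\<exists>B. finite B \<and> card B = k \<and> is_basis n B C)"

text \<open>Distinctness is needed because \<^term>\<open>set (rows G)\<close> forgets repeated rows.\<close>

definition generator_matrix :: "nat \<Rightarrow> nat \<Rightarrow> bit poly mat \<Rightarrow> bit poly vec set \<Rightarrow> bool" where
  "generator_matrix n k G C \<longleftrightarrow>
     G \<in> carrier_mat k n \<and> distinct (rows G) \<and> is_basis n (set (rows G)) C"

definition dual_code :: "nat \<Rightarrow> bit poly vec set \<Rightarrow> bit poly vec set" where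
  "dual_code n C = {f \<in> carrier_vec n. \<forall>c\<in>C. f \<bullet> c = 0}"

definition self_dual_conv_code :: "nat \<Rightarrow> nat \<Rightarrow> bit poly vec set \<Rightarrow> bool" where
  "self_dual_conv_code n k C \<longleftrightarrow> conv_code n k C \<and> C = dual_code n C"

text \<open>The matrix with first row \<^term>\<open>f\<close>, followed by the rows \<open>(a\<^sub>i, a\<^sub>i, g\<^sub>i)\<close>, where \<open>g\<^sub>i\<close> is row
  \<open>i\<close> of \<^term>\<open>G\<close>.\<close>

definition harada_munemasa_matrix ::
  "bit poly vec \<Rightarrow> bit poly vec \<Rightarrow> bit poly mat \<Rightarrow> bit poly mat" where
  "harada_munemasa_matrix f a G =
     mat_of_rows (dim_col G + 2)
       (f # map (\<lambda>i. vCons (a $ i) (vCons (a $ i) (row G i))) [0..<dim_row G])"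

end

theory Submission
  imports Defs
begin

text \<open>In characteristic 2 one has \<open>c \<bullet> c = (\<Sum>\<^sub>i c\<^sub>i)\<^sup>2\<close>, so every vector of a self-orthogonal code has
  coordinate sum 0. Hence the all-ones vector is orthogonal to a self-dual code \<open>C\<close> and therefore
  belongs to it. Having an entry 1, it is primitive, so by Bezout it is a member of some
  basis of \<open>C\<close>. With \<open>a\<^sub>1 = 1\<close> and \<open>G = (1 1)\<close>, which generates a self-dual \<open>(2,1)\<close> code, it is the
  second row of the Harada-Munemasa matrix, and \<open>f\<close> is the other basis vector.\<close>

text \<open>Extended Euclidean algorithm: a Bezout identity for \<open>y\<close> and
  \<open>x mod y\<close> becomes one for \<open>x\<close> and \<open>y\<close> on substituting
  \<open>x mod y = x - (x div y) * y\<close>. Being a combination of \<open>x\<close> and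
  \<open>y\<close> as well, the common divisor \<open>d\<close> is a greatest one.\<close>

lemma bezout_common_divisor:
  fixes x y :: "'a :: euclidean_ring"
  shows "\<exists>d s t. d = s * x + t * y \<and> d dvd x \<and> d dvd y"
proof (induction "euclidean_size y" arbitrary: x y rule: less_induct)
  case less
  show ?case
  proof (cases "y = 0")
    case True
    then show ?thesis by (intro exI[of _ x] exI[of _ 1] exI[of _ 0]) simp
  next
    case False
    then have "euclidean_size (x mod y) < euclidean_size y" by (rule mod_size_less)
    from less[OF this, of y] obtain d s t
      where d: "d = s * y + t * (x mod y)" "d dvd y" "d dvd x mod y" by blast
    then have "d dvd x" by (simp add: dvd_mod_iff)
    moreover have "d = t * x + (s - t * (x div y)) * y"
      unfolding d(1) by (simp add: algebra_simps minus_div_mult_eq_mod[symmetric])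
    ultimately show ?thesis using d(2) by blast
  qed
qed

context vec_module
begin

lemma lincomb_singleton:
  assumes "u \<in> carrier_vec n"
  shows "lincomb c {u} = c u \<cdot>\<^sub>v u"
  using assms lincomb_insert[of "{}" u c] by (simp add: lincomb_def)

lemma lincomb_pair:
  assumes "u \<in> carrier_vec n" "v \<in> carrier_vec n" "u \<noteq> v"
  shows "lincomb c {u, v} = c u \<cdot>\<^sub>v u + c v \<cdot>\<^sub>v v"
  using assms lincomb_insert[of "{v}" u c] by (simp add: lincomb_singleton)

lemma span_singleton:
  assumes "u \<in> carrier_vec n"
  shows "span {u} = {a \<cdot>\<^sub>v u | a. True}"
  using assms by (subst finite_span) (auto simp: lincomb_singleton)

lemma span_pair:
  assumes "u \<in> carrier_vec n" "v \<in> carrier_vec n" "u \<noteq> v"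
  shows "span {u, v} = {a \<cdot>\<^sub>v u + b \<cdot>\<^sub>v v | a b. True}"
proof -
  \<comment> \<open>\<open>lincomb\<close> takes its coefficients as a function on vectors; since
    \<open>u\<close> and \<open>v\<close> differ, one function can carry both \<open>a\<close> and
    \<open>b\<close>.\<close>
  have "\<exists>c. a \<cdot>\<^sub>v u + b \<cdot>\<^sub>v v = lincomb c {u, v}" for a b
    using assms by (intro exI[of _ "\<lambda>w. if w = u then a else b"]) (simp add: lincomb_pair)
  then show ?thesis
    using assms by (subst finite_span) (auto simp: lincomb_pair)
qed

lemma lin_indpt_singletonI:
  assumes "u \<in> carrier_vec n" "\<And>a. a \<cdot>\<^sub>v u = 0\<^sub>v n \<Longrightarrow> a = 0"
  shows "lin_indpt {u}"
  using assms by (intro finite_lin_indpt2) (auto simp: lincomb_singleton)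

lemma lin_indpt_pair_iff:
  assumes "u \<in> carrier_vec n" "v \<in> carrier_vec n" "u \<noteq> v"
  shows "lin_indpt {u, v} \<longleftrightarrow> (\<forall>a b. a \<cdot>\<^sub>v u + b \<cdot>\<^sub>v v = 0\<^sub>v n \<longrightarrow> a = 0 \<and> b = 0)"
proof
  assume indpt: "lin_indpt {u, v}"
  show "\<forall>a b. a \<cdot>\<^sub>v u + b \<cdot>\<^sub>v v = 0\<^sub>v n \<longrightarrow> a = 0 \<and> b = 0"
  proof (intro allI impI)
    fix a b assume zero: "a \<cdot>\<^sub>v u + b \<cdot>\<^sub>v v = 0\<^sub>v n"
    define c where "c = (\<lambda>w. if w = u then a else b)"
    have "lincomb c {u, v} = 0\<^sub>v n"
      using zero assms by (simp add: lincomb_pair c_def)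
    then have "c u = 0" "c v = 0"
      using indpt lin_dep_crit[where A = "{u, v}" and S = "{u, v}" and a = c] by auto
    then show "a = 0 \<and> b = 0" using assms(3) by (auto simp: c_def)
  qed
next
  assume "\<forall>a b. a \<cdot>\<^sub>v u + b \<cdot>\<^sub>v v = 0\<^sub>v n \<longrightarrow> a = 0 \<and> b = 0"
  then show "lin_indpt {u, v}"
    using assms by (intro finite_lin_indpt2) (auto simp: lincomb_pair)
qed

end

text \<open>Turns the set-based notion of basis into statements about two coefficients, so that the
  change of basis below is pure ring arithmetic. If \<open>u = v\<close>, the set would collapse to
  a single vector.\<close>

lemma is_basis_pair_iff:
  assumes "u \<in> carrier_vec n" "v \<in> carrier_vec n" "u \<noteq> v"
  shows "is_basis n {u, v} C \<longleftrightarrow>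
    (\<forall>a b. a \<cdot>\<^sub>v u + b \<cdot>\<^sub>v v = 0\<^sub>v n \<longrightarrow> a = 0 \<and> b = 0) \<and> C = {a \<cdot>\<^sub>v u + b \<cdot>\<^sub>v v | a b. True}"
proof -
  interpret vec_module "TYPE(bit poly)" n .
  show ?thesis
    unfolding is_basis_def lin_indpt_pair_iff[OF assms] span_pair[OF assms] using assms by auto
qed

text \<open>The matrix with rows \<open>(- t, s)\<close> and \<open>(x, y)\<close>, which expresses
  \<open>f, w\<close> in terms of \<open>u, v\<close>, has determinant
  \<open>- (s * x + t * y) = - 1\<close>. This is a unit, so the matrix is invertible over the
  polynomial ring and carries bases to bases.\<close>

lemma is_basis_exchange:
  assumes basis: "is_basis n {u, v} C"
    and carrier: "u \<in> carrier_vec n" "v \<in> carrier_vec n" and "u \<noteq> v"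
    and unimodular: "s * x + t * y = 1"
  defines "f \<equiv> (- t) \<cdot>\<^sub>v u + s \<cdot>\<^sub>v v" and "w \<equiv> x \<cdot>\<^sub>v u + y \<cdot>\<^sub>v v"
  shows "f \<noteq> w \<and> is_basis n {f, w} C"
proof -
  have fw: "f \<in> carrier_vec n" "w \<in> carrier_vec n"
    using carrier by (auto simp: f_def w_def)
  have indpt: "a = 0 \<and> b = 0" if "a \<cdot>\<^sub>v u + b \<cdot>\<^sub>v v = 0\<^sub>v n" for a b
    using basis that is_basis_pair_iff[OF carrier \<open>u \<noteq> v\<close>] by blast
  have C: "C = {a \<cdot>\<^sub>v u + b \<cdot>\<^sub>v v | a b. True}"
    using basis is_basis_pair_iff[OF carrier \<open>u \<noteq> v\<close>] by blast
  have expand: "a \<cdot>\<^sub>v f + b \<cdot>\<^sub>v w = (b * x - a * t) \<cdot>\<^sub>v u + (a * s + b * y) \<cdot>\<^sub>v v" for a b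
    unfolding f_def w_def using carrier by (intro eq_vecI) (auto simp: algebra_simps)
  have indpt': "a = 0 \<and> b = 0" if "a \<cdot>\<^sub>v f + b \<cdot>\<^sub>v w = 0\<^sub>v n" for a b
  proof -
    have zero: "b * x - a * t = 0" "a * s + b * y = 0"
      using indpt that unfolding expand by blast+
    \<comment> \<open>Cramer's rule: these combinations of the two equations in \<open>zero\<close>
      eliminate \<open>b\<close> and \<open>a\<close> respectively, leaving the determinant as a
      factor up to sign.\<close>
    have "a * (s * x + t * y) = x * (a * s + b * y) - y * (b * x - a * t)"
      "b * (s * x + t * y) = s * (b * x - a * t) + t * (a * s + b * y)"
      by (simp_all add: algebra_simps)
    then show ?thesis unfolding zero unimodular by simp
  qed
  have "f \<noteq> w"
  proof
    assume "f = w"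
    then have "1 \<cdot>\<^sub>v f + (- 1) \<cdot>\<^sub>v w = 0\<^sub>v n" using fw by (intro eq_vecI) auto
    from indpt'[OF this] show False by simp
  qed
  moreover have "C = {a \<cdot>\<^sub>v f + b \<cdot>\<^sub>v w | a b. True}"
  proof -
    \<comment> \<open>The coefficients are the row \<open>(a, b)\<close> times the inverse matrix,
      whose rows are \<open>(- y, s)\<close> and \<open>(x, t)\<close>.\<close>
    have "a \<cdot>\<^sub>v u + b \<cdot>\<^sub>v v = (b * x - a * y) \<cdot>\<^sub>v f + (a * s + b * t) \<cdot>\<^sub>v w" for a b
    proof -
      have "(a * s + b * t) * x - (b * x - a * y) * t = a * (s * x + t * y)"
        "(b * x - a * y) * s + (a * s + b * t) * y = b * (s * x + t * y)"
        by (simp_all add: algebra_simps)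
      then show ?thesis unfolding expand by (simp add: unimodular)
    qed
    then show ?thesis unfolding C using expand by blast
  qed
  ultimately show ?thesis
    using indpt' by (simp add: is_basis_pair_iff[OF fw])
qed

lemma add_self_bit_poly: "p + p = (0 :: bit poly)"
proof (rule poly_eqI)
  show "coeff (p + p) i = coeff 0 i" for i
    by (cases "coeff p i") (simp_all only: coeff_add coeff_0, simp_all)
qed

text \<open>Squaring is additive in characteristic 2: the two equal cross terms
  \<open>g i * sum g A\<close> cancel.\<close>

lemma sum_squares_bit_poly:
  fixes g :: "'a \<Rightarrow> bit poly"
  shows "(\<Sum>i\<in>A. g i * g i) = (\<Sum>i\<in>A. g i) * (\<Sum>i\<in>A. g i)"
proof (induction A rule: infinite_finite_induct)
  case (insert i A)
  have "g i * sum g A + sum g A * g i = 0"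
    using add_self_bit_poly[of "g i * sum g A"] by (simp add: mult.commute)
  then have "(g i + sum g A) * (g i + sum g A) = g i * g i + sum g A * sum g A"
    by (simp add: distrib_left distrib_right)
  with insert show ?case by simp
qed auto

lemma ones_in_self_dual:
  assumes "C = dual_code n C"
  shows "vec n (\<lambda>_. 1) \<in> C"
proof -
  have "vec n (\<lambda>_. 1) \<bullet> c = 0" if "c \<in> C" for c
  proof -
    have c: "c \<in> carrier_vec n" "c \<bullet> c = 0"
      using that assms by (auto simp: dual_code_def)
    \<comment> \<open>The square of the coordinate sum is 0, so the sum itself vanishes because
      polynomials over a field form an integral domain.\<close>
    have "(\<Sum>i<n. c $ i) * (\<Sum>i<n. c $ i) = c \<bullet> c"
      using c(1) by (simp add: scalar_prod_def lessThan_atLeast0 sum_squares_bit_poly)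
    then show ?thesis
      using c by (simp add: scalar_prod_def lessThan_atLeast0)
  qed
  then show ?thesis
    by (subst assms) (simp add: dual_code_def)
qed

lemma basis_with_unit_entry:
  assumes basis: "is_basis n {u, v} C"
    and carrier: "u \<in> carrier_vec n" "v \<in> carrier_vec n" and "u \<noteq> v"
    and "w \<in> C" "i < n" "w $ i = 1"
  shows "\<exists>f. f \<in> carrier_vec n \<and> f \<noteq> w \<and> is_basis n {f, w} C"
proof -
  obtain x y where w: "w = x \<cdot>\<^sub>v u + y \<cdot>\<^sub>v v"
    using basis is_basis_pair_iff[OF carrier \<open>u \<noteq> v\<close>] \<open>w \<in> C\<close> by blast
  obtain d s t where d: "d = s * x + t * y" "d dvd x" "d dvd y"
    using bezout_common_divisor by blast
  have "x * u $ i + y * v $ i = 1"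
    using \<open>w $ i = 1\<close> \<open>i < n\<close> carrier by (simp add: w)
  \<comment> \<open>A common divisor of the coordinates \<open>x, y\<close> of \<open>w\<close>
    divides every entry of \<open>w\<close>, in particular the entry 1. So \<open>d\<close> is a
    unit, and multiplying \<open>s\<close> and \<open>t\<close> by its inverse \<open>e\<close>
    makes the Bezout combination equal to 1.\<close>
  then have "d dvd 1" using d(2,3) by (metis dvd_add dvd_mult2)
  then obtain e where "1 = d * e" by (elim dvdE)
  then have "(e * s) * x + (e * t) * y = 1" by (simp add: d(1) algebra_simps)
  from is_basis_exchange[OF basis carrier \<open>u \<noteq> v\<close> this] carrier show ?thesis
    unfolding w by (intro exI[of _ "(- (e * t)) \<cdot>\<^sub>v u + (e * s) \<cdot>\<^sub>v v"]) auto
qed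

text \<open>The code generated by (1, 1), given by its parity check so that self-duality can be
  tested on coordinates.\<close>

definition repetition_code :: "bit poly vec set" where
  "repetition_code = {c \<in> carrier_vec 2. c $ 0 = c $ 1}"

lemma is_basis_repetition: "is_basis 2 {vec 2 (\<lambda>_. 1)} repetition_code"
proof -
  interpret vec_module "TYPE(bit poly)" 2 .
  have "a = 0" if "a \<cdot>\<^sub>v vec 2 (\<lambda>_. 1) = 0\<^sub>v 2" for a :: "bit poly"
    using arg_cong[OF that, of "\<lambda>v. v $ 0"] by simp
  then have "lin_indpt {vec 2 (\<lambda>_. 1)}"
    by (intro lin_indpt_singletonI) auto
  moreover have "c = c $ 0 \<cdot>\<^sub>v vec 2 (\<lambda>_. 1)" if "c \<in> repetition_code" for c
    using that by (intro eq_vecI) (auto simp: repetition_code_def less_2_cases_iff)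
  then have "{a \<cdot>\<^sub>v vec 2 (\<lambda>_. 1) | a. True} = repetition_code"
    by (auto simp: repetition_code_def)
  ultimately show ?thesis
    by (simp add: is_basis_def span_singleton)
qed

lemma self_dual_repetition: "self_dual_conv_code 2 1 repetition_code"
proof -
  interpret vec_module "TYPE(bit poly)" 2 .
  have "submodule class_ring repetition_code (poly_module 2)"
    using span_is_submodule[of "{vec 2 (\<lambda>_. 1)}"] is_basis_repetition by (simp add: is_basis_def)
  moreover have "repetition_code = dual_code 2 repetition_code"
  proof
    show "repetition_code \<subseteq> dual_code 2 repetition_code"
      by (auto simp: repetition_code_def dual_code_def scalar_prod_def numeral_2_eq_2 add_self_bit_poly)
    show "dual_code 2 repetition_code \<subseteq> repetition_code"
    proof
      fix c assume c: "c \<in> dual_code 2 repetition_code"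
      have "vec 2 (\<lambda>_. 1) \<in> repetition_code" by (simp add: repetition_code_def)
      then have "c $ 0 + c $ 1 = 0"
        using c by (auto simp: dual_code_def scalar_prod_def numeral_2_eq_2)
      \<comment> \<open>In characteristic 2 every element is its own negative, so orthogonality to
        (1, 1) is exactly equality of the two entries.\<close>
      then have "c $ 0 = c $ 1"
        using add_self_bit_poly[of "c $ 1"] by (metis add_right_cancel)
      then show "c \<in> repetition_code"
        using c by (simp add: repetition_code_def dual_code_def)
    qed
  qed
  ultimately show ?thesis
    using is_basis_repetition
    by (auto simp: self_dual_conv_code_def conv_code_def intro!: exI[of _ "{vec 2 (\<lambda>_. 1)}"])
qed

theorem lemma14:
  fixes C :: "bit poly vec set"
  assumes "self_dual_conv_code 4 2 C"
  shows "\<exists>(C\<^sub>0 :: bit poly vec set) (G :: bit poly mat) (a\<^sub>1 :: bit poly) (f :: bit poly vec).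
           self_dual_conv_code 2 1 C\<^sub>0 \<and> generator_matrix 2 1 G C\<^sub>0 \<and> f \<in> carrier_vec 4 \<and>
           generator_matrix 4 2 (harada_munemasa_matrix f (vec_of_list [a\<^sub>1]) G) C"
proof -
  define ones :: "bit poly vec" where "ones = vec 4 (\<lambda>_. 1)"
  define G :: "bit poly mat" where "G = mat_of_rows 2 [vec 2 (\<lambda>_. 1)]"
  obtain u v where basis: "is_basis 4 {u, v} C" and "u \<noteq> v"
    using assms by (auto simp: self_dual_conv_code_def conv_code_def card_2_iff)
  then have carrier: "u \<in> carrier_vec 4" "v \<in> carrier_vec 4"
    by (auto simp: is_basis_def)
  have "ones \<in> C"
    unfolding ones_def using assms by (intro ones_in_self_dual) (simp add: self_dual_conv_code_def)
  moreover have "ones $ 0 = 1" by (simp add: ones_def)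
  ultimately obtain f where f: "f \<in> carrier_vec 4" "f \<noteq> ones" "is_basis 4 {f, ones} C"
    using basis_with_unit_entry[OF basis carrier \<open>u \<noteq> v\<close>, of ones 0] by auto
  have rows_G: "rows G = [vec 2 (\<lambda>_. 1)]"
    unfolding G_def by (subst rows_mat_of_rows) auto
  have "generator_matrix 2 1 G repetition_code"
    using is_basis_repetition mat_of_rows_carrier(1)[of 2 "[vec 2 (\<lambda>_. 1)]"]
    by (simp add: generator_matrix_def rows_G) (simp add: G_def)
  \<comment> \<open>With \<open>a\<^sub>1 = 1\<close> the row below \<open>f\<close> is (1, 1)
    followed by the generator (1, 1) of the repetition code, that is, the all-ones vector.\<close>
  moreover have "vCons 1 (vCons 1 (row G 0)) = ones"
    by (simp add: G_def ones_def vec_Suc numeral_eq_Suc o_def)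
  then have "harada_munemasa_matrix f (vec_of_list [1]) G = mat_of_rows 4 [f, ones]"
    by (simp add: harada_munemasa_matrix_def G_def)
  moreover have "rows (mat_of_rows 4 [f, ones]) = [f, ones]"
    using f(1) by (subst rows_mat_of_rows) (auto simp: ones_def)
  ultimately show ?thesis
    using self_dual_repetition f
    by (intro exI[of _ repetition_code] exI[of _ G] exI[of _ 1] exI[of _ f])
      (auto simp: generator_matrix_def)
qed

end
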